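(* Let $m\ge n\ge0$ be integers, let $\lambda$ be a partition inside an $n\times m$ board ($n$ rows, $m$ columns), and let $k=\ell(\lambda)$ be its number of nonzero parts. Then $$\begin{bmatrix} m-k\\ n-k\end{bmatrix}H_k^{m+n-k}(\lambda)=q^{k(n-k)}\,[m+n-2k]_{m-k}\,H_k^{m,n}(\lambda),$$ and for every $0\le r<k$, $$\begin{bmatrix} m-r\\ n-r\end{bmatrix}H_r^{m+n-r-1}(\lambda)=q^{r(n-r-1)}\,[m+n-2r-1]_{m-r-1}\,H_r^{m,n}(\lambda)+\sum_{j=r+1}^n q^{r(n-1-j)}\begin{bmatrix} j\\ r\end{bmatrix}\frac{[m+n-r-j-1]_{m-r}}{[n-r]}\,H_j^{m,n}(\lambda).$$
   Context: $q$-notation: $[x]=(1-q^x)/(1-q)$, $[a]_k=[a][a-1]\cdots[a-k+1]$, $[a]!=[a]_a$, $\begin{bmatrix} a\\ b\end{bmatrix}=[a]_b/[b]!$, and $(x;q)_k=\prod_{i=0}^{k-1}(1-xq^i)$; $q$ is an indeterminate. Boards and partitions: cell $(i,j)$ is in row $i$ from the top and column $j$ from the left. A partition $\lambda=(\lambda_1\ge\cdots\ge\lambda_n\ge 0)$ with $\lambda_1\le m$ is identified with the set of cells $(i,j)$ with $j\le\lambda_i$; $|\lambda|$ is its number of cells. $q$-rook numbers: $R_k(\lambda)=\sum_p q^{\mathrm{inv}(p)}$ over all placements $p$ of $k$ non-attacking rooks on cells of $\lambda$ (no two in the same row or column), where $\mathrm{inv}(p)$ is the number of cells of $\lambda$ left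 after each rook cancels its own cell, the cells of $\lambda$ North of it in its column, and the cells West of it in its row. $q$-hit numbers: for $\lambda$ inside an $n\times m$ board with $n\le m$, the $H_i^{m,n}(\lambda)$ are defined by $$\sum_{i=0}^n H_i^{m,n}(\lambda)x^i=\frac{q^{-|\lambda|}}{[m-n]!}\sum_{i=0}^n R_i(\lambda)\,[m-i]!\,(-1)^i q^{mi-\binom i2}(x;q)_i ,$$ and for square boards $H_i^{N}(\lambda)=H_i^{N,N}(\lambda)$. *)

theory Defs
  imports
    "HOL-Computational_Algebra.Polynomial"
    "HOL-Computational_Algebra.Fraction_Field"
begin

text \<open>
  The indeterminate \<open>q\<close> is the generator of the field of rational functions over the rationals.
  All \<open>q\<close>-numbers live in this field.
\<close>

type_synonym ratfun = "rat poly fract"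

definition q :: ratfun where
  "q = Fract [:0, 1:] 1"

definition qbr :: "int \<Rightarrow> ratfun" where
  "qbr x = (1 - q powi x) / (1 - q)"

definition qfall :: "int \<Rightarrow> nat \<Rightarrow> ratfun" where
  "qfall a k = (\<Prod>i<k. qbr (a - int i))"

definition qfact :: "nat \<Rightarrow> ratfun" where
  "qfact a = qfall (int a) a"

definition qbinom :: "int \<Rightarrow> nat \<Rightarrow> ratfun" where
  "qbinom a b = qfall a b / qfact b"

text \<open>\<open>(x;q)\<^sub>k\<close>, as a polynomial in \<open>x\<close>.\<close>

definition qpoch :: "nat \<Rightarrow> ratfun poly" where
  "qpoch k = (\<Prod>i<k. [:1, - (q ^ i):])"

text \<open>
  A cell is a pair (row, column). Rows are numbered from the top and columns from the left, both
  starting at 1, so North means a smaller row index and West a smaller column index.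
\<close>

type_synonym cell = "nat \<times> nat"

definition partition_in_board :: "nat \<Rightarrow> nat \<Rightarrow> nat list \<Rightarrow> bool" where
  "partition_in_board n m lam \<longleftrightarrow>
     length lam = n \<and> sorted_wrt (\<ge>) lam \<and> (\<forall>a\<in>set lam. a \<le> m)"

definition num_parts :: "nat list \<Rightarrow> nat" where
  "num_parts lam = length (filter (\<lambda>a. a \<noteq> 0) lam)"

text \<open>
  Trailing zero parts contribute no cells, so the same set of cells represents the partition
  inside boards with different numbers of rows.
\<close>

definition cells :: "nat list \<Rightarrow> cell set" where
  "cells lam = {(i, j). 1 \<le> i \<and> i \<le> length lam \<and> 1 \<le> j \<and> j \<le> lam ! (i - 1)}"

definition rook_placements :: "cell set \<Rightarrow> nat \<Rightarrow> cell set set" where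
  "rook_placements B k =
     {p. p \<subseteq> B \<and> finite p \<and> card p = k \<and>
         (\<forall>c\<in>p. \<forall>d\<in>p. c \<noteq> d \<longrightarrow> fst c \<noteq> fst d \<and> snd c \<noteq> snd d)}"

definition cancelled_by :: "cell \<Rightarrow> cell set \<Rightarrow> cell set" where
  "cancelled_by c B =
     {d \<in> B. d = c \<or> (snd d = snd c \<and> fst d < fst c) \<or> (fst d = fst c \<and> snd d < snd c)}"

definition rook_inv :: "cell set \<Rightarrow> cell set \<Rightarrow> nat" where
  "rook_inv B p = card (B - (\<Union>c\<in>p. cancelled_by c B))"

definition qrook :: "cell set \<Rightarrow> nat \<Rightarrow> ratfun" where
  "qrook B k = (\<Sum>p\<in>rook_placements B k. q ^ rook_inv B p)"

text \<open>
  The generating polynomial in \<open>x\<close> of the \<open>q\<close>-hit numbers of a board with \<open>n\<close> rows and \<open>m\<close>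
  columns. It is meant for \<open>n \<le> m\<close>. As in the notation \<open>H\<^sub>i\<^sup>m\<^sup>,\<^sup>n\<close>, the number of columns comes first.
\<close>

definition qhit_poly :: "nat \<Rightarrow> nat \<Rightarrow> cell set \<Rightarrow> ratfun poly" where
  "qhit_poly m n B =
     smult (q powi (- int (card B)) / qfact (m - n))
       (\<Sum>i\<le>n. smult (qrook B i * qfact (m - i) * (- 1) ^ i
                        * q powi (int (m * i) - int (i choose 2)))
                 (qpoch i))"

definition qhit :: "nat \<Rightarrow> nat \<Rightarrow> cell set \<Rightarrow> nat \<Rightarrow> ratfun" where
  "qhit m n B i = coeff (qhit_poly m n B) i"

abbreviation qhit_sq :: "nat \<Rightarrow> cell set \<Rightarrow> nat \<Rightarrow> ratfun" where
  "qhit_sq N B i \<equiv> qhit N N B i"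

lemma degree_qpoch_le: "degree (qpoch k) \<le> k"
proof -
  have "degree (qpoch k) \<le> (\<Sum>i<k. degree [:1, - (q ^ i):])"
    unfolding qpoch_def using degree_prod_sum_le[of "{..<k}" "\<lambda>i. [:1, - (q ^ i):]"]
    by (simp only: o_def finite_lessThan)
  also have "\<dots> \<le> (\<Sum>i<k. 1)"
    by (intro sum_mono) (simp add: degree_pCons_le)
  finally show ?thesis by simp
qed

text \<open>The coefficients \<open>qhit m n B i\<close> with \<open>i \<le> n\<close> are all the coefficients of the polynomial.\<close>

lemma qhit_generating: "(\<Sum>i\<le>n. monom (qhit m n B i) i) = qhit_poly m n B"
proof -
  have "degree (qhit_poly m n B) \<le> n"
    unfolding qhit_poly_def
    by (rule order.trans[OF degree_smult_le], rule degree_sum_le)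
       (auto intro: order.trans[OF degree_smult_le] order.trans[OF degree_qpoch_le])
  then show ?thesis
    unfolding qhit_def by (rule poly_as_sum_of_monoms')
qed

end

theory Submission
  imports Defs
begin

text \<open>
  The \<open>q\<close>-rook numbers \<open>R\<^sub>i(\<lambda>)\<close> vanish for \<open>i > k\<close>, so both sides of each identity are linear
  combinations of \<open>R\<^sub>0, \<dots>, R\<^sub>k\<close>, and the identities hold coefficient by coefficient.

  By the \<open>q\<close>-binomial theorem (\<open>coeff_qpoch\<close>) the coefficient of \<open>x\<^sup>j\<close> in \<open>(x;q)\<^sub>i\<close> is
  \<open>(-1)\<^sup>j\<close> times a power of \<open>q\<close> times \<open>[i choose j]\<close>; in particular it is zero for \<open>j > i\<close>. Hence only
  \<open>R\<^sub>k\<close> contributes to the \<open>k\<close>-th hit numbers, and the first identity compares two monomials.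

  In the second identity, the first summand on the right is what the summand of the sum becomes at
  \<open>j = r\<close>. The right side is therefore one sum over \<open>r \<le> j \<le> n\<close>. After the factor \<open>[i choose r]\<close> is
  taken out of \<open>[i choose j] [j choose r]\<close> (\<open>qbinom_mult_qbinom\<close>), the coefficient of \<open>R\<^sub>i\<close>
  in it is, up to an explicit factor, the \<open>(i-r)\<close>-th \<open>q\<close>-difference of the \<open>q\<close>-falling factorial \<open>[x]\<^sub>m\<^sub>-\<^sub>r\<close> at \<open>x = m+n-2r-1\<close>.
  Such differences have a closed form (\<open>qdifference_qfall\<close>), which gives the left side
  (\<open>qhit_recursion_term\<close>).
\<close>

section \<open>Arithmetic of \<open>q\<close>-numbers\<close>

lemma q_power: "q ^ n = Fract (monom 1 n) 1"
proof (induction n)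
  case 0
  show ?case by (simp add: One_fract_def)
next
  case (Suc n)
  then show ?case by (simp add: q_def monom_Suc)
qed

lemma q_nonzero [simp]: "q \<noteq> 0"
  by (simp add: q_def Zero_fract_def eq_fract)

lemma q_power_neq_1:
  assumes "n > 0"
  shows "q ^ n \<noteq> 1"
proof
  assume "q ^ n = 1"
  then have "monom 1 n = (1 :: rat poly)"
    by (simp add: q_power One_fract_def eq_fract)
  then have "degree (monom (1 :: rat) n) = 0" by simp
  then show False using assms by (simp add: degree_monom_eq)
qed

lemma q_powi_eq_1_iff: "q powi x = 1 \<longleftrightarrow> x = 0"
proof
  assume h: "q powi x = 1"
  show "x = 0"
  proof (rule ccontr)
    assume "x \<noteq> 0"
    then have "q ^ nat \<bar>x\<bar> \<noteq> 1" by (intro q_power_neq_1) auto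
    with h show False by (auto simp: power_int_def power_inverse split: if_splits)
  qed
qed simp

lemma q_neq_1 [simp]: "q \<noteq> 1" "1 - q \<noteq> 0"
  using q_power_neq_1[of 1] by auto

lemma qbr_eq_0_iff [simp]: "qbr x = 0 \<longleftrightarrow> x = 0"
  by (auto simp: qbr_def q_powi_eq_1_iff[symmetric])

lemma qbr_add: "qbr (x + y) = qbr x + q powi x * qbr y"
  by (simp add: qbr_def power_int_add diff_divide_distrib[symmetric] add_divide_distrib[symmetric]
      algebra_simps)

lemma qfall_0 [simp]: "qfall x 0 = 1"
  by (simp add: qfall_def)

lemma qfall_Suc: "qfall x (Suc k) = qfall x k * qbr (x - int k)"
  by (simp add: qfall_def)

lemma qfall_Suc_left: "qfall x (Suc k) = qbr x * qfall (x - 1) k"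
  unfolding qfall_def by (subst prod.lessThan_Suc_shift) (simp add: algebra_simps)

lemma qfall_add: "qfall x (a + b) = qfall x a * qfall (x - int a) b"
  by (induction b) (simp_all add: qfall_Suc algebra_simps)

lemma qfall_eq_0: "0 \<le> x \<Longrightarrow> x < int k \<Longrightarrow> qfall x k = 0"
  unfolding qfall_def by (rule prod_zero) (auto intro!: bexI[of _ "nat x"])

lemma qfact_nonzero [simp]: "qfact a \<noteq> 0"
  by (auto simp: qfact_def qfall_def)

lemma qfact_Suc: "qfact (Suc a) = qbr (int a + 1) * qfact a"
  unfolding qfact_def by (subst qfall_Suc_left) (simp add: algebra_simps)

lemma qfall_mult_qfact: "qfall (int a + int b) b * qfact a = qfact (a + b)"
  using qfall_add[of "int (a + b)" b a] by (simp add: qfact_def add.commute)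

lemma qbinom_0 [simp]: "qbinom x 0 = 1"
  by (simp add: qbinom_def qfact_def)

lemma qbinom_eq_0: "i < j \<Longrightarrow> qbinom (int i) j = 0"
  by (simp add: qbinom_def qfall_eq_0)

lemma qbinom_Suc_Suc:
  "qbinom (x + 1) (Suc j) = qbinom x (Suc j) + q powi (x - int j) * qbinom x j"
proof -
  have "qbr (x + 1) = qbr (x - int j) + q powi (x - int j) * qbr (int j + 1)"
    using qbr_add[of "x - int j" "int j + 1"] by simp
  then have "qfall (x + 1) (Suc j)
      = qfall x (Suc j) + q powi (x - int j) * (qbr (int j + 1) * qfall x j)"
    using qfall_Suc_left[of "x + 1" j] by (simp add: qfall_Suc[of x] algebra_simps)
  moreover have "qbr (int j + 1) \<noteq> 0" by simp
  ultimately show ?thesis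
    by (simp add: qbinom_def qfact_Suc add_divide_distrib)
qed

lemma qbinom_qfact: "qbinom (int a + int b) b * (qfact a * qfact b) = qfact (a + b)"
  using qfall_mult_qfact[of a b] by (simp add: qbinom_def)

text \<open>The \<open>q\<close>-analogue of trinomial revision.\<close>

lemma qbinom_mult_qbinom:
  "qbinom (int r + int t) (r + s) * qbinom (int r + int s) r
   = qbinom (int r + int t) r * qbinom (int t) s"
proof -
  have a: "qfact (r + s) = qfall (int r + int s) r * qfact s"
    using qfall_mult_qfact[of s r] by (simp add: add.commute)
  have "qfall (int r + int s) r \<noteq> 0"
    using qfact_nonzero[of "r + s"] unfolding a by auto
  then show ?thesis
    by (simp add: qbinom_def a qfall_add)
qed

section \<open>The coefficients of \<open>(x;q)\<^sub>i\<close> and \<open>q\<close>-differences\<close>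

lemma qpoch_Suc: "qpoch (Suc i) = qpoch i * [:1, - (q ^ i):]"
  by (simp add: qpoch_def)

lemma coeff_qpoch_Suc_0: "coeff (qpoch (Suc i)) 0 = coeff (qpoch i) 0"
  by (simp add: qpoch_Suc mult.commute[of "qpoch i"])

lemma coeff_qpoch_Suc_Suc:
  "coeff (qpoch (Suc i)) (Suc j) = coeff (qpoch i) (Suc j) - q ^ i * coeff (qpoch i) j"
  by (simp add: qpoch_Suc mult.commute[of "qpoch i"])

lemma coeff_qpoch: "coeff (qpoch i) j = (- 1) ^ j * q ^ (j choose 2) * qbinom (int i) j"
proof (induction i arbitrary: j)
  case 0
  show ?case
    by (cases j) (simp_all add: qpoch_def qbinom_eq_0[of 0, simplified] binomial_eq_0)
next
  case (Suc i)
  show ?case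
  proof (cases j)
    case 0
    then show ?thesis by (simp add: coeff_qpoch_Suc_0 Suc.IH binomial_eq_0)
  next
    case (Suc b)
    have "q ^ i * q ^ (b choose 2) * qbinom (int i) b
        = q ^ (Suc b choose 2) * (q powi (int i - int b) * qbinom (int i) b)"
      by (simp add: power_int_diff numeral_2_eq_2 power_add)
    moreover have "qbinom (int (Suc i)) (Suc b)
        = qbinom (int i) (Suc b) + q powi (int i - int b) * qbinom (int i) b"
      using qbinom_Suc_Suc[of "int i" b] by (simp add: add.commute)
    ultimately show ?thesis
      by (simp add: Suc coeff_qpoch_Suc_Suc Suc.IH distrib_left mult.assoc mult.left_commute[of "q ^ i"]
          del: of_nat_Suc)
  qed
qed

lemma coeff_qpoch_eq_0: "i < j \<Longrightarrow> coeff (qpoch i) j = 0"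
  by (simp add: coeff_qpoch qbinom_eq_0)

text \<open>
  With \<open>E\<close> the shift \<open>x \<mapsto> x - 1\<close>, the left side is \<open>(E;q)\<^sub>t\<close> applied to \<open>[x]\<^sub>a\<close>, the \<open>t\<close>-th
  \<open>q\<close>-difference; it is again a \<open>q\<close>-falling factorial up to a factor. Since
  \<open>(E;q)\<^sub>t\<^sub>+\<^sub>1 = (E;q)\<^sub>t (1 - q\<^sup>t E)\<close>, the difference \<open>S\<^sub>t\<^sub>+\<^sub>1(x)\<close> is \<open>S\<^sub>t(x) - q\<^sup>t S\<^sub>t(x - 1)\<close>.
\<close>

lemma qdifference_qfall:
  assumes "t \<le> a"
  shows "(\<Sum>s\<le>t. coeff (qpoch t) s * qfall (x - int s) a)
       = q powi (int t * (x - int a)) * qfall (int a) t * qfall (x - int t) (a - t)"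
  using assms
proof (induction t arbitrary: x)
  case 0
  show ?case by (simp add: qpoch_def)
next
  case (Suc t)
  define b where "b = a - Suc t"
  have ab: "a - t = Suc b" "a - Suc t = b" and b_int: "int b = int a - int t - 1"
    using Suc.prems by (auto simp: b_def)
  let ?S = "\<lambda>x. \<Sum>s\<le>t. coeff (qpoch t) s * qfall (x - int s) a"
  have "(\<Sum>s\<le>Suc t. coeff (qpoch (Suc t)) s * qfall (x - int s) a)
      = coeff (qpoch t) 0 * qfall x a
        + (\<Sum>s\<le>t. (coeff (qpoch t) (Suc s) - q ^ t * coeff (qpoch t) s) * qfall (x - 1 - int s) a)"
    by (subst sum.atMost_Suc_shift)
       (simp add: coeff_qpoch_Suc_0 coeff_qpoch_Suc_Suc algebra_simps)
  also have "\<dots> = coeff (qpoch t) 0 * qfall x a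
        + (\<Sum>s\<le>t. coeff (qpoch t) (Suc s) * qfall (x - int (Suc s)) a) - q ^ t * ?S (x - 1)"
    by (simp add: sum_subtractf sum_distrib_left left_diff_distrib mult.assoc algebra_simps)
  also have "coeff (qpoch t) 0 * qfall x a
        + (\<Sum>s\<le>t. coeff (qpoch t) (Suc s) * qfall (x - int (Suc s)) a)
      = (\<Sum>s\<le>Suc t. coeff (qpoch t) s * qfall (x - int s) a)"
    by (subst sum.atMost_Suc_shift) simp
  also have "\<dots> = ?S x"
    by (simp add: coeff_qpoch_eq_0)
  finally have rec: "(\<Sum>s\<le>Suc t. coeff (qpoch (Suc t)) s * qfall (x - int s) a)
      = ?S x - q ^ t * ?S (x - 1)" .
  have e: "q ^ t * q powi (int t * (x - 1 - int a)) = q powi (int t * (x - int a))"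
    by (simp add: power_int_of_nat[symmetric] power_int_add[symmetric] algebra_simps
        del: power_int_of_nat)
  have d: "qfall (x - int t) (Suc b) - qfall (x - 1 - int t) (Suc b)
      = q powi (x - int a) * qbr (int a - int t) * qfall (x - int (Suc t)) b"
  proof -
    have "qbr (x - int t) = qbr (x - int a) + q powi (x - int a) * qbr (int a - int t)"
      using qbr_add[of "x - int a" "int a - int t"] by simp
    moreover have "qfall (x - int t) (Suc b) = qbr (x - int t) * qfall (x - int (Suc t)) b"
      by (subst qfall_Suc_left) (simp add: algebra_simps)
    moreover have "qfall (x - 1 - int t) (Suc b) = qfall (x - int (Suc t)) b * qbr (x - int a)"
      by (subst qfall_Suc) (simp add: b_int algebra_simps)
    ultimately show ?thesis by (simp add: algebra_simps)
  qed
  have "?S x - q ^ t * ?S (x - 1) = q powi (int t * (x - int a)) * qfall (int a) t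
      * (qfall (x - int t) (Suc b) - qfall (x - 1 - int t) (Suc b))"
  proof -
    have "t \<le> a" using Suc.prems by simp
    then show ?thesis
      unfolding Suc.IH[OF \<open>t \<le> a\<close>] ab e[symmetric] by (simp add: algebra_simps)
  qed
  also have "\<dots> = (q powi (int t * (x - int a)) * q powi (x - int a)) * qfall (int a) (Suc t)
      * qfall (x - int (Suc t)) b"
    unfolding d by (simp add: qfall_Suc mult_ac)
  also have "q powi (int t * (x - int a)) * q powi (x - int a) = q powi (int (Suc t) * (x - int a))"
    by (simp add: power_int_add[symmetric] algebra_simps)
  finally show ?case unfolding rec ab .
qed

section \<open>\<open>q\<close>-rook and \<open>q\<close>-hit numbers of a partition\<close>

text \<open>The rooks of a placement stand in different rows, so there are no more rooks than rows that
  meet the board.\<close>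

lemma qrook_eq_0:
  assumes "finite A" and "fst ` B \<subseteq> A" and "card A < i"
  shows "qrook B i = 0"
proof -
  have "rook_placements B i = {}"
  proof (rule ccontr)
    assume "rook_placements B i \<noteq> {}"
    then obtain p where p: "p \<subseteq> B" "card p = i"
        "\<forall>c\<in>p. \<forall>d\<in>p. c \<noteq> d \<longrightarrow> fst c \<noteq> fst d"
      unfolding rook_placements_def by blast
    then have "inj_on fst p" by (auto simp: inj_on_def)
    moreover have "fst ` p \<subseteq> A" using p assms(2) by blast
    ultimately have "i \<le> card A" using p(2) assms(1) card_inj_on_le by blast
    then show False using assms by simp
  qed
  then show ?thesis by (simp add: qrook_def)
qed

lemma fst_cells_subset:
  assumes "sorted_wrt (\<ge>) lam"
  shows "fst ` cells lam \<subseteq> {1..num_parts lam}"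
proof -
  have "i \<le> num_parts lam" if "1 \<le> i" "i \<le> length lam" "1 \<le> lam ! (i - 1)" for i
  proof -
    have "lam ! a \<noteq> 0" if "a < i" for a
    proof -
      have "lam ! (i - 1) \<le> lam ! a"
        using that \<open>i \<le> length lam\<close> assms by (cases "a = i - 1") (auto simp: sorted_wrt_iff_nth_less)
      then show ?thesis using \<open>1 \<le> lam ! (i - 1)\<close> by linarith
    qed
    then have "{..<i} \<subseteq> {a. a < length lam \<and> lam ! a \<noteq> 0}"
      using that by auto
    then have "card {..<i} \<le> card {a. a < length lam \<and> lam ! a \<noteq> 0}"
      by (intro card_mono) auto
    then show ?thesis by (simp add: num_parts_def length_filter_conv_card)
  qed
  then show ?thesis by (auto simp: cells_def)
qed

text \<open>The first factor of each summand depends on the board and on \<open>i\<close> but not on \<open>m\<close>, \<open>n\<close> and \<open>j\<close>,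
  so it is common to the hit numbers of \<open>B\<close> in boards of different shapes.\<close>

lemma qhit_eq_sum:
  "qhit m n B j = (\<Sum>i\<le>n. (q powi (- int (card B)) * qrook B i * (- 1) ^ i
     * q powi (- int (i choose 2))) * (qfact (m - i) * q ^ (m * i) / qfact (m - n))
     * coeff (qpoch i) j)"
proof -
  have "q powi (int (m * i) - int (i choose 2)) = q ^ (m * i) * q powi (- int (i choose 2))" for i
    using power_int_add[of q "int (m * i)" "- int (i choose 2)"]
    by (simp del: of_nat_mult)
  then show ?thesis
    unfolding qhit_def qhit_poly_def
    by (simp only: coeff_smult coeff_sum sum_distrib_left divide_inverse mult_ac)
qed

section \<open>Comparing hit numbers of the two boards\<close>

text \<open>
  The two sides are the coefficients of the \<open>i\<close>-th \<open>q\<close>-rook number in the two sides of the recursion,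
  with the common factor from \<open>qhit_eq_sum\<close> removed.
\<close>

lemma qhit_recursion_term:
  assumes "r < n" and "n \<le> m" and "i \<le> n"
  shows "qbinom (int m - int r) (n - r)
       * (qfact (m + n - r - 1 - i) * q ^ ((m + n - r - 1) * i) * coeff (qpoch i) r)
     = (\<Sum>j = r..n. q powi (int r * (int n - 1 - int j)) * qbinom (int j) r
          * (qfall (int m + int n - int r - int j - 1) (m - r) / qbr (int n - int r))
          * (qfact (m - i) * q ^ (m * i) / qfact (m - n) * coeff (qpoch i) j))"
proof (cases "r \<le> i")
  case False
  then show ?thesis by (simp add: coeff_qpoch_eq_0)
next
  case True
  define a b t where "a = m - r" and "b = n - r - 1" and "t = i - r"
  have m: "m = r + a" and n: "n = r + Suc b" and i: "i = r + t" and le: "t \<le> Suc b" "b < a"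
    using assms True by (auto simp: a_def b_def t_def)
  define x where "x = int a + int b"
  let ?c = "(- 1) ^ r * q ^ (r choose 2) * qbinom (int i) r * q ^ (r * b)"
  \<comment> \<open>The sign and the power of \<open>q\<close> that depend on \<open>s = j - r\<close> are those in \<open>(x;q)\<^sub>t\<close>: the term
    \<open>r s\<close> in the binomial coefficient of \<open>r + s\<close> cancels against \<open>r (n - 1 - j)\<close>.\<close>
  have summand: "q powi (int r * (int n - 1 - int (r + s))) * qbinom (int (r + s)) r
      * coeff (qpoch i) (r + s) = ?c * coeff (qpoch t) s" for s
  proof -
    have ch: "r + s choose 2 = (r choose 2) + (s choose 2) + r * s"
      by (induction s) (simp_all add: numeral_2_eq_2)
    have "q powi (int r * (int n - 1 - int (r + s))) * q ^ (r + s choose 2)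
        = q ^ (r choose 2) * q ^ (r * b) * q ^ (s choose 2)"
      by (simp add: power_int_of_nat[symmetric] power_int_add[symmetric] ch n algebra_simps
          del: power_int_of_nat)
    moreover have "qbinom (int i) (r + s) * qbinom (int (r + s)) r
        = qbinom (int i) r * qbinom (int t) s"
      using qbinom_mult_qbinom[of r t s] by (simp add: i)
    moreover have "q powi (int r * (int n - 1 - int (r + s))) * qbinom (int (r + s)) r
          * coeff (qpoch i) (r + s)
        = (- 1) ^ r * (- 1) ^ s
          * (q powi (int r * (int n - 1 - int (r + s))) * q ^ (r + s choose 2))
          * (qbinom (int i) (r + s) * qbinom (int (r + s)) r)"
      by (simp only: coeff_qpoch power_add mult_ac)
    ultimately show ?thesis
      by (simp only: coeff_qpoch mult_ac)
  qed
  have qf: "qfall (int m + int n - int r - int (r + s) - 1) (m - r) = qfall (x - int s) a" for s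
    by (simp add: m n x_def algebra_simps)
  let ?d = "qfact (m - i) * q ^ (m * i) / qfact (m - n) / qbr (int n - int r)"
  have "(\<Sum>j = r..n. q powi (int r * (int n - 1 - int j)) * qbinom (int j) r
          * (qfall (int m + int n - int r - int j - 1) (m - r) / qbr (int n - int r))
          * (qfact (m - i) * q ^ (m * i) / qfact (m - n) * coeff (qpoch i) j))
      = (\<Sum>s\<le>Suc b. q powi (int r * (int n - 1 - int (r + s))) * qbinom (int (r + s)) r
          * (qfall (int m + int n - int r - int (r + s) - 1) (m - r) / qbr (int n - int r))
          * (qfact (m - i) * q ^ (m * i) / qfact (m - n) * coeff (qpoch i) (r + s)))"
    by (rule sum.reindex_bij_witness[where i = "\<lambda>s. r + s" and j = "\<lambda>j. j - r"])
       (use n in auto)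
  also have "\<dots> = (\<Sum>s\<le>Suc b. ?d * qfall (x - int s) a
      * (q powi (int r * (int n - 1 - int (r + s))) * qbinom (int (r + s)) r
         * coeff (qpoch i) (r + s)))"
    by (rule sum.cong) (simp_all only: qf times_divide_eq_left times_divide_eq_right mult_ac)
  also have "\<dots> = ?d * ?c * (\<Sum>s\<le>Suc b. coeff (qpoch t) s * qfall (x - int s) a)"
    unfolding summand sum_distrib_left by (rule sum.cong) (simp_all only: mult_ac)
  also have "(\<Sum>s\<le>Suc b. coeff (qpoch t) s * qfall (x - int s) a)
      = (\<Sum>s\<le>t. coeff (qpoch t) s * qfall (x - int s) a)"
    by (rule sum.mono_neutral_right) (use le in \<open>auto simp: coeff_qpoch_eq_0\<close>)
  also have "\<dots> = q ^ (t * b) * qfall (int a) t * qfall (x - int t) (a - t)"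
    using le by (subst qdifference_qfall)
      (auto simp: x_def power_int_of_nat[symmetric] simp del: power_int_of_nat)
  finally have rhs: "(\<Sum>j = r..n. q powi (int r * (int n - 1 - int j)) * qbinom (int j) r
          * (qfall (int m + int n - int r - int j - 1) (m - r) / qbr (int n - int r))
          * (qfact (m - i) * q ^ (m * i) / qfact (m - n) * coeff (qpoch i) j))
      = ?d * ?c * (q ^ (t * b) * qfall (int a) t * qfall (x - int t) (a - t))" .
  have f1: "qfact (a - t) * qfall (int a) t = qfact a"
    using qfall_mult_qfact[of "a - t" t] le by (simp add: of_nat_diff mult.commute)
  have f2: "qfall (x - int t) (a - t) = qfact (a + b - t) / qfact b"
  proof -
    have idx: "int b + int (a - t) = x - int t" "b + (a - t) = a + b - t"
      using le by (simp_all add: x_def of_nat_diff)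
    show ?thesis
      using qfall_mult_qfact[of b "a - t", unfolded idx] by (simp add: nonzero_eq_divide_eq)
  qed
  have f3: "qbinom (int a) (Suc b) = qfact a / (qfact (a - Suc b) * (qbr (int b + 1) * qfact b))"
    using qbinom_qfact[of "a - Suc b" "Suc b"] le
    by (simp add: of_nat_diff qfact_Suc nonzero_eq_divide_eq)
  have idx: "int m - int r = int a" "n - r = Suc b" "m + n - r - 1 - i = a + b - t"
      "m - i = a - t" "m - n = a - Suc b" "int n - int r = int b + 1"
    using le by (auto simp: m n i)
  have "(m + n - r - 1) * i = m * i + r * b + t * b"
    by (simp add: m n i algebra_simps)
  then have pw: "q ^ ((m + n - r - 1) * i) = q ^ (m * i) * q ^ (r * b) * q ^ (t * b)"
    by (simp add: power_add)
  show ?thesis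
    unfolding rhs unfolding idx pw f2 f3 coeff_qpoch f1[symmetric] by (simp add: mult_ac)
qed

theorem lemma4p3:
  fixes m n k :: nat and lam :: "nat list"
  assumes "n \<le> m"
    and "partition_in_board n m lam"
    and "k = num_parts lam"
  shows "qbinom (int m - int k) (n - k) * qhit_sq (m + n - k) (cells lam) k
           = q ^ (k * (n - k)) * qfall (int m + int n - 2 * int k) (m - k)
             * qhit m n (cells lam) k
       \<and> (\<forall>r<k.
           qbinom (int m - int r) (n - r) * qhit_sq (m + n - r - 1) (cells lam) r
           = q powi (int r * (int n - int r - 1))
               * qfall (int m + int n - 2 * int r - 1) (m - r - 1) * qhit m n (cells lam) r
             + (\<Sum>j = r + 1..n. q powi (int r * (int n - 1 - int j)) * qbinom (int j) r
                  * (qfall (int m + int n - int r - int j - 1) (m - r) / qbr (int n - int r))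
                  * qhit m n (cells lam) j))"
proof -
  let ?B = "cells lam"
  define w where "w i = q powi (- int (card ?B)) * qrook ?B i * (- 1) ^ i
     * q powi (- int (i choose 2))" for i
  have kn: "k \<le> n"
    using assms by (auto simp: partition_in_board_def num_parts_def)
  have w0: "w i = 0" if "k < i" for i
    using qrook_eq_0[of "{1..k}" ?B i] fst_cells_subset[of lam] assms that
    by (simp add: w_def partition_in_board_def)
  have hit: "qhit M N ?B j
      = (\<Sum>i\<le>n. w i * (qfact (M - i) * q ^ (M * i) / qfact (M - N)) * coeff (qpoch i) j)"
    if "n \<le> N" for M N j
    unfolding qhit_eq_sum w_def[symmetric]
    by (rule sum.mono_neutral_right) (use that kn w0 in auto)
  have top: "qhit M N ?B k = w k * (qfact (M - k) * q ^ (M * k) / qfact (M - N)) * coeff (qpoch k) k"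
    if "n \<le> N" for M N
  proof -
    have "w i * c * coeff (qpoch i) k = 0" if "i \<noteq> k" for i c
      using that by (cases "i < k") (auto simp: coeff_qpoch_eq_0 w0)
    then show ?thesis
      unfolding hit[OF that] using kn
      by (subst sum.mono_neutral_right[of "{..n}" "{k}"]) auto
  qed
  have "qbinom (int m - int k) (n - k) * qhit_sq (m + n - k) ?B k
           = q ^ (k * (n - k)) * qfall (int m + int n - 2 * int k) (m - k) * qhit m n ?B k"
  proof -
    define a b where "a = m - n" and "b = n - k"
    have n: "n = k + b" and m: "m = k + b + a"
      using assms(1) kn by (auto simp: a_def b_def)
    have f1: "qbinom (int m - int k) (n - k) = qfact (a + b) / (qfact a * qfact b)"
      using qbinom_qfact[of a b] by (simp add: m n field_simps)
    have f2: "qfall (int m + int n - 2 * int k) (a + b) = qfact (a + b + b) / qfact b"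
      using qfall_mult_qfact[of b "a + b"] by (simp add: m n field_simps)
    have pw: "q ^ ((m + n - k) * k) = q ^ (k * (n - k)) * q ^ (m * k)"
      by (simp add: m n power_add[symmetric] algebra_simps)
    have idx: "m + n - k - k = a + b + b" "m - k = a + b" "m - n = a"
      by (auto simp: m n)
    have N: "n \<le> m + n - k" using kn assms(1) by simp
    show ?thesis
      unfolding top[OF N] top[OF order_refl] f1 f2 pw idx
      by (simp add: mult_ac qfact_def[of 0])
  qed
  moreover have "qbinom (int m - int r) (n - r) * qhit_sq (m + n - r - 1) ?B r
           = q powi (int r * (int n - int r - 1))
               * qfall (int m + int n - 2 * int r - 1) (m - r - 1) * qhit m n ?B r
             + (\<Sum>j = r + 1..n. q powi (int r * (int n - 1 - int j)) * qbinom (int j) r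
                  * (qfall (int m + int n - int r - int j - 1) (m - r) / qbr (int n - int r))
                  * qhit m n ?B j)" if "r < k" for r
  proof -
    let ?M = "m + n - r - 1"
    let ?c = "\<lambda>j. q powi (int r * (int n - 1 - int j)) * qbinom (int j) r
                  * (qfall (int m + int n - int r - int j - 1) (m - r) / qbr (int n - int r))"
    have rn: "r < n" and M: "n \<le> ?M" using that kn assms(1) by auto
    \<comment> \<open>The last factor of \<open>[m+n-2r-1]\<^sub>m\<^sub>-\<^sub>r\<close> is \<open>[n-r]\<close>, which cancels the denominator.\<close>
    have c_r: "?c r = q powi (int r * (int n - int r - 1))
        * qfall (int m + int n - 2 * int r - 1) (m - r - 1)"
    proof -
      have "qfall (int m + int n - int r - int r - 1) (Suc (m - r - 1))
          = qfall (int m + int n - 2 * int r - 1) (m - r - 1) * qbr (int n - int r)"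
        using rn assms(1) by (subst qfall_Suc) (simp add: of_nat_diff algebra_simps)
      moreover have "Suc (m - r - 1) = m - r" using rn assms(1) by simp
      moreover have "qbinom (int r) r = 1" by (simp add: qbinom_def qfact_def[symmetric])
      moreover have "qbr (int n - int r) \<noteq> 0" using rn by simp
      ultimately show ?thesis by (simp add: algebra_simps)
    qed
    have "qbinom (int m - int r) (n - r) * qhit_sq ?M ?B r
        = (\<Sum>i\<le>n. w i * (qbinom (int m - int r) (n - r)
            * (qfact (?M - i) * q ^ (?M * i) * coeff (qpoch i) r)))"
      unfolding hit[OF M] sum_distrib_left by (rule sum.cong) (simp_all add: qfact_def[of 0] mult_ac)
    also have "\<dots> = (\<Sum>i\<le>n. w i * (\<Sum>j = r..n. ?c j
          * (qfact (m - i) * q ^ (m * i) / qfact (m - n) * coeff (qpoch i) j)))"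
      using rn assms(1) by (intro sum.cong refl) (subst qhit_recursion_term, auto)
    also have "\<dots> = (\<Sum>j = r..n. ?c j * qhit m n ?B j)"
      unfolding hit[OF order_refl] sum_distrib_left
      by (subst sum.swap) (intro sum.cong refl, simp only: mult_ac)
    also have "\<dots> = ?c r * qhit m n ?B r + (\<Sum>j = r + 1..n. ?c j * qhit m n ?B j)"
      using rn by (subst sum.atLeast_Suc_atMost) auto
    finally show ?thesis unfolding c_r .
  qed
  ultimately show ?thesis by blast
qed

end
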